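(* Let $\nu\in\mathbb{C}$ with $\Re(\nu)>0$, and let $f,g$ be complex-valued measurable functions on $(0,\infty)$ such that the integrals involved in the identities below converge absolutely. Then $$\int_{0}^{\infty}y^{2\nu-1}\,\mathcal{L}_{2}\{f(x);y\}\,\mathcal{L}_{2}\{g(u);y\}\,dy=\frac{\Gamma(\nu)}{2}\int_{0}^{\infty}x\,f(x)\,\mathcal{P}_{\nu,2}\{g(u);x\}\,dx,$$ $$\int_{0}^{\infty}y^{2\nu-1}\,\mathcal{L}_{2}\{f(x);y\}\,\mathcal{L}_{2}\{g(u);y\}\,dy=\frac{\Gamma(\nu)}{2}\int_{0}^{\infty}u\,g(u)\,\mathcal{P}_{\nu,2}\{f(x);u\}\,du,$$ and $$\int_{0}^{\infty}x\,f(x)\,\mathcal{P}_{\nu,2}\{g(u);x\}\,dx=\int_{0}^{\infty}u\,g(u)\,\mathcal{P}_{\nu,2}\{f(x);u\}\,du.$$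
   Context: For a function $f$ on $(0,\infty)$ and $y>0$, the $\mathcal{L}_2$-transform is $$\mathcal{L}_{2}\{f(x);y\}=\int_0^\infty x\,\exp(-x^{2}y^{2})\,f(x)\,dx,$$ and the $\mathcal{P}_{\nu,2}$-transform is $$\mathcal{P}_{\nu,2}\{f(x);y\}=\int_{0}^{\infty}\frac{x\,f(x)}{(x^{2}+y^{2})^{\nu}}\,dx.$$ In the notation $T\{f(x);y\}$, the first entry is the function being transformed (of the indicated dummy variable) and $y$ is the argument of the transform. Absolute convergence of an iterated integral means that it is finite when the fully written-out integrand is replaced by its absolute value. Powers of positive reals with complex exponent are principal. *)

theory Defs
  imports "HOL-Analysis.Analysis"
begin

text \<open>
  Only the values on the open half-line matter. The integrals are Lebesgue integrals, which take the
  value 0 where the integrand is not integrable. On complex numbers \<open>powr\<close> is the principal power.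
\<close>

definition L2_transform :: "(real \<Rightarrow> complex) \<Rightarrow> real \<Rightarrow> complex" where
  "L2_transform f y =
     (LINT x:{0<..}|lebesgue. of_real x * of_real (exp (- (x\<^sup>2 * y\<^sup>2))) * f x)"

definition P2_transform :: "complex \<Rightarrow> (real \<Rightarrow> complex) \<Rightarrow> real \<Rightarrow> complex" where
  "P2_transform \<nu> f y =
     (LINT x:{0<..}|lebesgue. of_real x * f x / of_real (x\<^sup>2 + y\<^sup>2) powr \<nu>)"

end

theory Submission
  imports Defs
begin

text \<open>
  Written out, the product \<open>L2_transform f y * L2_transform g y\<close> is a double integral over \<open>x\<close> and \<open>u\<close>
  whose kernel is \<open>exp (- (x\<^sup>2 + u\<^sup>2) * y\<^sup>2)\<close>. Integrate it against \<open>y powr (2 * \<nu> - 1)\<close> and move the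
  integral over \<open>y\<close> to the inside, as the absolute convergence of the triple integral permits
  (\<open>integrable_triple_product\<close>, \<open>triple_integral_interchange\<close>). What remains inside is a Mellin
  transform of a Gaussian, which \<open>gaussian_mellin_integral\<close> evaluates to
  \<open>Gamma \<nu> / 2 / (x\<^sup>2 + u\<^sup>2) powr \<nu>\<close>: up to the factor \<open>Gamma \<nu> / 2\<close>, this is the kernel of
  \<open>P2_transform \<nu>\<close>.

  That kernel is symmetric in \<open>x\<close> and \<open>u\<close>, and the two outer integrals may be taken in either order.
  With the integral over \<open>u\<close> inside, the transform of \<open>g\<close> appears; with the integral over \<open>x\<close> inside,
  the transform of \<open>f\<close>. This gives the first two identities. The third one follows by comparing
  them, because \<open>Gamma\<close> does not vanish on the right half-plane.
\<close>

text \<open>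
  The substitution \<open>t = c * y\<^sup>2\<close> turns Euler's integral for \<open>Gamma \<nu>\<close> into this one: the factor
  \<open>t powr (\<nu> - 1)\<close> and the derivative \<open>2 * c * y\<close> together contribute
  \<open>2 * c powr \<nu> * y powr (2 * \<nu> - 1)\<close>.
\<close>

lemma gaussian_mellin_integral:
  fixes \<nu> :: complex and c :: real
  assumes "Re \<nu> > 0" "c > 0"
  shows "(LINT y|lebesgue_on {0<..}. of_real y powr (2 * \<nu> - 1) * of_real (exp (- (c * y\<^sup>2))))
           = Gamma \<nu> / 2 / of_real c powr \<nu>"
proof -
  define h :: "real \<Rightarrow> complex" where "h = (\<lambda>t. of_real t powr (\<nu> - 1) / of_real (exp t))"
  define k :: "real \<Rightarrow> complex" where
    "k = (\<lambda>y. of_real y powr (2 * \<nu> - 1) * of_real (exp (- (c * y\<^sup>2))))"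
  define g :: "real \<Rightarrow> real" where "g = (\<lambda>y. c * y\<^sup>2)"
  have c0: "of_real c \<noteq> (0::complex)" using assms by simp
  have img: "g ` {0<..} = {0<..}"
  proof (intro equalityI subsetI)
    fix t :: real assume "t \<in> {0<..}"
    then have "t = g (sqrt (t / c))" "sqrt (t / c) \<in> {0<..}"
      using assms by (auto simp: g_def)
    then show "t \<in> g ` {0<..}" by blast
  qed (use assms in \<open>auto simp: g_def\<close>)
  have inj: "inj_on g {0<..}"
    using assms by (auto simp: inj_on_def g_def power2_eq_iff_nonneg)
  have "h absolutely_integrable_on {0<..} \<and> integral {0<..} h = Gamma \<nu>"
    unfolding h_def using assms(1)
    by (intro conjI absolutely_integrable_Gamma_integral' integral_unique Gamma_integral_complex')
  then have sub: "(\<lambda>y. \<bar>2 * c * y\<bar> *\<^sub>R h (g y)) absolutely_integrable_on {0<..} \<and>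
      integral {0<..} (\<lambda>y. \<bar>2 * c * y\<bar> *\<^sub>R h (g y)) = Gamma \<nu>"
    by (subst has_absolute_integral_change_of_variables_real)
       (use inj img in \<open>auto simp: g_def intro!: derivative_eq_intros\<close>)
  have pull: "\<bar>2 * c * y\<bar> *\<^sub>R h (g y) = 2 * of_real c powr \<nu> * k y" if "y \<in> {0<..}" for y
  proof -
    from that have y: "y > 0" by simp
    then have y0: "of_real y \<noteq> (0::complex)" by simp
    \<comment> \<open>Principal powers are multiplicative here because the bases are positive reals.\<close>
    have yy: "of_real (y\<^sup>2) powr (\<nu> - 1) = (of_real y :: complex) powr (2 * \<nu> - 2)"
    proof -
      have "of_real (y\<^sup>2) powr (\<nu> - 1) = (of_real y * of_real y :: complex) powr (\<nu> - 1)"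
        by (simp add: power2_eq_square)
      also have "\<dots> = of_real y powr (\<nu> - 1) * of_real y powr (\<nu> - 1)"
        using y by (intro powr_times_real) auto
      also have "\<dots> = (of_real y :: complex) powr (2 * \<nu> - 2)"
        by (simp add: powr_add[symmetric])
      finally show ?thesis .
    qed
    have "of_real (g y) powr (\<nu> - 1) = (of_real c * of_real (y\<^sup>2) :: complex) powr (\<nu> - 1)"
      by (simp add: g_def)
    also have "\<dots> = of_real c powr (\<nu> - 1) * of_real (y\<^sup>2) powr (\<nu> - 1)"
      using assms by (intro powr_times_real) auto
    finally have e: "of_real (g y) powr (\<nu> - 1)
        = of_real c powr (\<nu> - 1) * (of_real y :: complex) powr (2 * \<nu> - 2)"
      by (simp only: yy)
    have p1: "of_real c * of_real c powr (\<nu> - 1) = (of_real c :: complex) powr \<nu>"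
      using c0 by (simp add: powr_diff)
    have p2: "of_real y * of_real y powr (2 * \<nu> - 2) = (of_real y :: complex) powr (2 * \<nu> - 1)"
      using y0 by (simp add: powr_diff power2_eq_square)
    have "\<bar>2 * c * y\<bar> *\<^sub>R h (g y) = 2 * (of_real c * of_real c powr (\<nu> - 1))
        * (of_real y * of_real y powr (2 * \<nu> - 2)) * of_real (exp (- g y))"
      using y assms by (simp add: h_def e scaleR_conv_of_real exp_minus divide_inverse)
    also have "\<dots> = 2 * of_real c powr \<nu> * k y"
      unfolding p1 p2 by (simp add: k_def g_def)
    finally show ?thesis .
  qed
  have "(\<lambda>y. 2 * of_real c powr \<nu> * k y) absolutely_integrable_on {0<..}"
    using sub by (subst set_integrable_cong[OF refl refl pull, symmetric]) auto
  then have ai: "k absolutely_integrable_on {0<..}"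
    using c0 by (simp add: set_integrable_mult_right_iff)
  have "integral {0<..} (\<lambda>y. 2 * of_real c powr \<nu> * k y) = Gamma \<nu>"
    using sub by (subst Henstock_Kurzweil_Integration.integral_cong[OF pull, symmetric]) auto
  then have "2 * of_real c powr \<nu> * integral {0<..} k = Gamma \<nu>"
    by simp
  then have "integral {0<..} k = Gamma \<nu> / 2 / of_real c powr \<nu>"
    using c0 by (simp add: field_simps)
  moreover have "(LINT y|lebesgue_on {0<..}. k y) = integral {0<..} k"
    using ai by (intro lebesgue_integral_eq_integral) (auto simp: integrable_restrict_space set_integrable_def)
  ultimately show ?thesis
    by (simp add: k_def)
qed

text \<open>
  Tonelli's theorem, applied twice. The nesting \<open>A \<Otimes>\<^sub>M (B \<Otimes>\<^sub>M C)\<close> treats the two inner variables as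
  one, so that the outer variable can be moved past both of them in a single step.
\<close>

lemma integrable_triple_product:
  fixes h :: "'a \<times> 'b \<times> 'c \<Rightarrow> 'd :: {banach, second_countable_topology}"
  assumes A: "sigma_finite_measure A" and B: "sigma_finite_measure B" and C: "sigma_finite_measure C"
    and h [measurable]: "h \<in> borel_measurable (A \<Otimes>\<^sub>M (B \<Otimes>\<^sub>M C))"
    and fin: "(\<integral>\<^sup>+y. \<integral>\<^sup>+x. \<integral>\<^sup>+u. ennreal (norm (h (y, x, u))) \<partial>C \<partial>B \<partial>A) < \<infinity>"
  shows "integrable (A \<Otimes>\<^sub>M (B \<Otimes>\<^sub>M C)) h"
proof (rule integrableI_bounded[OF h])
  interpret BC: pair_sigma_finite B C using B C by (simp add: pair_sigma_finite_def)
  interpret A_BC: pair_sigma_finite A "B \<Otimes>\<^sub>M C"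
    using A by (simp add: pair_sigma_finite_def BC.sigma_finite_measure_axioms)
  have "(\<integral>\<^sup>+p. ennreal (norm (h p)) \<partial>(A \<Otimes>\<^sub>M (B \<Otimes>\<^sub>M C)))
      = (\<integral>\<^sup>+y. \<integral>\<^sup>+q. ennreal (norm (h (y, q))) \<partial>(B \<Otimes>\<^sub>M C) \<partial>A)"
    by (simp add: sigma_finite_measure.nn_integral_fst[OF BC.sigma_finite_measure_axioms, symmetric])
  also have "\<dots> = (\<integral>\<^sup>+y. \<integral>\<^sup>+x. \<integral>\<^sup>+u. ennreal (norm (h (y, x, u))) \<partial>C \<partial>B \<partial>A)"
    by (intro nn_integral_cong) (simp add: sigma_finite_measure.nn_integral_fst[OF C, symmetric])
  finally show "(\<integral>\<^sup>+p. ennreal (norm (h p)) \<partial>(A \<Otimes>\<^sub>M (B \<Otimes>\<^sub>M C))) < \<infinity>"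
    using fin by simp
qed

text \<open>
  Fubini's theorem on \<open>A \<times> (B \<times> C)\<close> moves the integral over \<open>A\<close> to the inside. The function of two
  variables obtained in this way is again integrable, so Fubini's theorem on \<open>B \<times> C\<close> yields both
  orders of the remaining integrals.
\<close>

lemma triple_integral_interchange:
  fixes h :: "'a \<times> 'b \<times> 'c \<Rightarrow> 'd :: {banach, second_countable_topology}"
  assumes A: "sigma_finite_measure A" and B: "sigma_finite_measure B" and C: "sigma_finite_measure C"
    and int: "integrable (A \<Otimes>\<^sub>M (B \<Otimes>\<^sub>M C)) h"
  shows "(LINT y|A. LINT x|B. LINT u|C. h (y, x, u)) = (LINT x|B. LINT u|C. LINT y|A. h (y, x, u))"
    and "(LINT y|A. LINT x|B. LINT u|C. h (y, x, u)) = (LINT u|C. LINT x|B. LINT y|A. h (y, x, u))"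
proof -
  interpret BC: pair_sigma_finite B C using B C by (simp add: pair_sigma_finite_def)
  interpret A_BC: pair_sigma_finite A "B \<Otimes>\<^sub>M C"
    using A by (simp add: pair_sigma_finite_def BC.sigma_finite_measure_axioms)
  have h [measurable]: "h \<in> borel_measurable (A \<Otimes>\<^sub>M (B \<Otimes>\<^sub>M C))"
    using int by (rule borel_measurable_integrable)
  have inner: "integrable (B \<Otimes>\<^sub>M C) (\<lambda>q. LINT y|A. h (y, q))"
    using A_BC.integrable_snd[of "\<lambda>y q. h (y, q)"] int by simp
  \<comment> \<open>A section of \<open>h\<close> need only be integrable for almost every \<open>y\<close>; elsewhere the iterated and the
    double integral may differ.\<close>
  have "(LINT y|A. LINT x|B. LINT u|C. h (y, x, u)) = (LINT y|A. LINT q|(B \<Otimes>\<^sub>M C). h (y, q))"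
  proof (rule integral_cong_AE)
    show "AE y in A. (LINT x|B. LINT u|C. h (y, x, u)) = (LINT q|(B \<Otimes>\<^sub>M C). h (y, q))"
      using A_BC.AE_integrable_fst'[OF int] by eventually_elim (drule BC.integral_fst', simp)
  qed measurable
  also have "\<dots> = (LINT q|(B \<Otimes>\<^sub>M C). LINT y|A. h (y, q))"
    using A_BC.Fubini_integral[of "\<lambda>y q. h (y, q)"] int by simp
  finally have *: "(LINT y|A. LINT x|B. LINT u|C. h (y, x, u)) = \<dots>" .
  show "(LINT y|A. LINT x|B. LINT u|C. h (y, x, u)) = (LINT x|B. LINT u|C. LINT y|A. h (y, x, u))"
    unfolding * using BC.integral_fst'[OF inner] by simp
  show "(LINT y|A. LINT x|B. LINT u|C. h (y, x, u)) = (LINT u|C. LINT x|B. LINT y|A. h (y, x, u))"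
    unfolding * using BC.integral_snd[of "\<lambda>x u. LINT y|A. h (y, x, u)"] inner by (simp add: case_prod_unfold)
qed

text \<open>
  Completion adds no mass to a Borel set, so a countable exhaustion by Borel sets of finite measure
  remains one for Lebesgue measure.
\<close>

lemma sigma_finite_lebesgue_on:
  fixes S :: "'a :: euclidean_space set"
  assumes "S \<in> sets lebesgue"
  shows "sigma_finite_measure (lebesgue_on S)"
proof (rule sigma_finite_measure_restrict_space[OF _ assms])
  obtain \<C> :: "'a set set" where "countable \<C>" "\<C> \<subseteq> sets lborel" "\<Union>\<C> = space lborel"
      "\<forall>a\<in>\<C>. emeasure lborel a \<noteq> \<infinity>"
    using lborel.sigma_finite_countable by blast
  then show "sigma_finite_measure (lebesgue :: 'a measure)"
    by (intro sigma_finite_measure.intro exI[of _ \<C>]) auto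
qed

lemma set_integral_lebesgue_on:
  fixes f :: "'a :: euclidean_space \<Rightarrow> 'b :: {banach, second_countable_topology}"
  assumes "S \<in> sets lebesgue"
  shows "(LINT x:S|lebesgue. f x) = (LINT x|lebesgue_on S. f x)"
  using assms by (simp add: set_lebesgue_integral_def integral_restrict_space)

lemma set_nn_integral_lebesgue_on:
  fixes f :: "'a :: euclidean_space \<Rightarrow> ennreal"
  assumes "S \<in> sets lebesgue"
  shows "(\<integral>\<^sup>+x\<in>S. f x \<partial>lebesgue) = (\<integral>\<^sup>+x. f x \<partial>lebesgue_on S)"
  using assms by (simp add: nn_integral_restrict_space)

theorem theorem7:
  fixes \<nu> :: complex and f g :: "real \<Rightarrow> complex"
  assumes "Re \<nu> > 0"
    and "f \<in> borel_measurable (lebesgue_on {0<..})"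
    and "g \<in> borel_measurable (lebesgue_on {0<..})"
    and "(\<integral>\<^sup>+y\<in>{0<..}. (\<integral>\<^sup>+x\<in>{0<..}. (\<integral>\<^sup>+u\<in>{0<..}.
            ennreal (norm (of_real y powr (2 * \<nu> - 1)
              * (of_real x * of_real (exp (- (x\<^sup>2 * y\<^sup>2))) * f x)
              * (of_real u * of_real (exp (- (u\<^sup>2 * y\<^sup>2))) * g u)))
          \<partial>lebesgue) \<partial>lebesgue) \<partial>lebesgue) < \<infinity>"
    and "(\<integral>\<^sup>+x\<in>{0<..}. (\<integral>\<^sup>+u\<in>{0<..}.
            ennreal (norm (of_real x * f x * (of_real u * g u / of_real (u\<^sup>2 + x\<^sup>2) powr \<nu>)))
          \<partial>lebesgue) \<partial>lebesgue) < \<infinity>"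
    and "(\<integral>\<^sup>+u\<in>{0<..}. (\<integral>\<^sup>+x\<in>{0<..}.
            ennreal (norm (of_real u * g u * (of_real x * f x / of_real (x\<^sup>2 + u\<^sup>2) powr \<nu>)))
          \<partial>lebesgue) \<partial>lebesgue) < \<infinity>"
  shows "(LINT y:{0<..}|lebesgue. of_real y powr (2 * \<nu> - 1) * L2_transform f y * L2_transform g y)
           = Gamma \<nu> / 2 * (LINT x:{0<..}|lebesgue. of_real x * f x * P2_transform \<nu> g x)
       \<and> (LINT y:{0<..}|lebesgue. of_real y powr (2 * \<nu> - 1) * L2_transform f y * L2_transform g y)
           = Gamma \<nu> / 2 * (LINT u:{0<..}|lebesgue. of_real u * g u * P2_transform \<nu> f u)
       \<and> (LINT x:{0<..}|lebesgue. of_real x * f x * P2_transform \<nu> g x)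
           = (LINT u:{0<..}|lebesgue. of_real u * g u * P2_transform \<nu> f u)"
proof -
  define M where "M = lebesgue_on {0::real<..}"
  have sf: "sigma_finite_measure M"
    unfolding M_def by (rule sigma_finite_lebesgue_on) simp
  have set_int: "(LINT x:{0<..}|lebesgue. k x) = (LINT x|M. k x)" for k :: "real \<Rightarrow> complex"
    unfolding M_def by (rule set_integral_lebesgue_on) simp
  have set_nn: "(\<integral>\<^sup>+x\<in>{0<..}. k x \<partial>lebesgue) = (\<integral>\<^sup>+x. k x \<partial>M)" for k :: "real \<Rightarrow> ennreal"
    unfolding M_def by (rule set_nn_integral_lebesgue_on) simp
  have [measurable]: "f \<in> borel_measurable M" "g \<in> borel_measurable M"
    using assms(2,3) by (simp_all add: M_def)
  have [measurable]: "(\<lambda>x. x) \<in> M \<rightarrow>\<^sub>M borel"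
    unfolding M_def by (intro measurable_restrict_space1 measurable_completion) simp
  have [measurable]: "(\<lambda>y. of_real y powr (2 * \<nu> - 1) :: complex) \<in> borel_measurable M"
    unfolding M_def
    by (intro continuous_imp_measurable_on_sets_lebesgue continuous_intros) auto
  define h where "h = (\<lambda>(y, x, u). of_real y powr (2 * \<nu> - 1)
      * (of_real x * of_real (exp (- (x\<^sup>2 * y\<^sup>2))) * f x)
      * (of_real u * of_real (exp (- (u\<^sup>2 * y\<^sup>2))) * g u))"
  have "h \<in> borel_measurable (M \<Otimes>\<^sub>M (M \<Otimes>\<^sub>M M))"
    unfolding h_def by measurable
  then have int: "integrable (M \<Otimes>\<^sub>M (M \<Otimes>\<^sub>M M)) h"
    using assms(4) by (intro integrable_triple_product sf) (simp_all add: set_nn h_def)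

  \<comment> \<open>Constants may be pulled into and out of a Bochner integral even where it diverges, since it is
    then 0 by convention; so this equation holds without any exceptional set of \<open>y\<close>.\<close>
  have lhs: "(LINT y|M. of_real y powr (2 * \<nu> - 1) * L2_transform f y * L2_transform g y)
      = (LINT y|M. LINT x|M. LINT u|M. h (y, x, u))"
    by (simp only: L2_transform_def set_int h_def prod.case
        integral_mult_right_zero integral_mult_left_zero)
  have kernel: "(LINT y|M. h (y, x, u))
      = Gamma \<nu> / 2 * (of_real x * f x * (of_real u * g u / of_real (x\<^sup>2 + u\<^sup>2) powr \<nu>))"
    if "x > 0" "u > 0" for x u
  proof -
    have "h (y, x, u) = (of_real x * f x * (of_real u * g u))
        * (of_real y powr (2 * \<nu> - 1) * of_real (exp (- ((x\<^sup>2 + u\<^sup>2) * y\<^sup>2))))" for y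
    proof -
      have "exp (- ((x\<^sup>2 + u\<^sup>2) * y\<^sup>2)) = exp (- (x\<^sup>2 * y\<^sup>2)) * exp (- (u\<^sup>2 * y\<^sup>2))"
        by (simp add: exp_add[symmetric] algebra_simps)
      then show ?thesis by (simp only: h_def prod.case of_real_mult mult_ac)
    qed
    then have "(LINT y|M. h (y, x, u)) = (of_real x * f x * (of_real u * g u))
        * (LINT y|M. of_real y powr (2 * \<nu> - 1) * of_real (exp (- ((x\<^sup>2 + u\<^sup>2) * y\<^sup>2))))"
      by simp
    also have "(LINT y|M. of_real y powr (2 * \<nu> - 1) * of_real (exp (- ((x\<^sup>2 + u\<^sup>2) * y\<^sup>2))))
        = Gamma \<nu> / 2 / of_real (x\<^sup>2 + u\<^sup>2) powr \<nu>"
      unfolding M_def using assms(1) that by (intro gaussian_mellin_integral) (auto intro: add_pos_pos)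
    finally show ?thesis by simp
  qed
  have space_M: "space M = {0<..}" by (simp add: M_def)
  have "(LINT x|M. LINT u|M. LINT y|M. h (y, x, u))
      = (LINT x|M. LINT u|M. Gamma \<nu> / 2 * (of_real x * f x * (of_real u * g u / of_real (u\<^sup>2 + x\<^sup>2) powr \<nu>)))"
    by (intro Bochner_Integration.integral_cong refl) (auto simp: space_M kernel add.commute)
  also have "\<dots> = Gamma \<nu> / 2 * (LINT x|M. of_real x * f x * P2_transform \<nu> g x)"
    by (simp only: integral_mult_right_zero P2_transform_def set_int)
  finally have 1: "(LINT x|M. LINT u|M. LINT y|M. h (y, x, u)) = \<dots>" .
  have "(LINT u|M. LINT x|M. LINT y|M. h (y, x, u))
      = (LINT u|M. LINT x|M. Gamma \<nu> / 2 * (of_real u * g u * (of_real x * f x / of_real (x\<^sup>2 + u\<^sup>2) powr \<nu>)))"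
    by (intro Bochner_Integration.integral_cong refl) (auto simp: space_M kernel)
  also have "\<dots> = Gamma \<nu> / 2 * (LINT u|M. of_real u * g u * P2_transform \<nu> f u)"
    by (simp only: integral_mult_right_zero P2_transform_def set_int)
  finally have 2: "(LINT u|M. LINT x|M. LINT y|M. h (y, x, u)) = \<dots>" .
  have first: "(LINT y|M. of_real y powr (2 * \<nu> - 1) * L2_transform f y * L2_transform g y)
      = Gamma \<nu> / 2 * (LINT x|M. of_real x * f x * P2_transform \<nu> g x)"
    using lhs triple_integral_interchange(1)[OF sf sf sf int] 1 by simp
  have second: "(LINT y|M. of_real y powr (2 * \<nu> - 1) * L2_transform f y * L2_transform g y)
      = Gamma \<nu> / 2 * (LINT u|M. of_real u * g u * P2_transform \<nu> f u)"
    using lhs triple_integral_interchange(2)[OF sf sf sf int] 2 by simp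
  have "Gamma \<nu> \<noteq> 0"
    using assms(1) by (auto simp: Gamma_eq_zero_iff elim!: nonpos_Ints_cases)
  then show ?thesis
    unfolding set_int using first second by simp
qed

end
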